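(* Every class of graphs of bounded merge-width has bounded flip-width.
   Context: Graphs are finite, simple and undirected: $G=(V,E(G))$ with $E(G)\subseteq\binom V2$. Merge-width. A construction sequence on $V$ is a sequence of steps maintaining a partition $\mathcal P$ of $V$ and a partition of $\binom V2$ into edges $E$, non-edges $N$, and unresolved pairs $U$. Initially $\mathcal P$ is the partition into singletons and $U=\binom V2$. In each step one of three operations is performed: merge two parts $A,B\in\mathcal P$, replacing them by $A\cup B$; resolve positively a pair of parts $A,B\in\mathcal P$ (possibly $A=B$), moving all $\{a,b\}\in U$ with $a\in A,b\in B$ from $U$ to $E$; or resolve negatively such a pair of parts, moving these pairs from $U$ to $N$. In the end $\mathcal P$ has one part and $U=\emptyset$; it is then a construction sequence of the graph $(V,E)$. Its radius-$r$ width is the least $k$ such that at every step, for every $v\in V$, at most $k$ parts of the current $\mathcal P$ contain a vertex reachable from $v$ by a path of length at most $r$ in the graph $(V,E\cup N)$ for the current $E,N$. The radius-$r$ merge-width $\mathrm{mw}_r(G)$ is the least radius-$r$ width of a construction sequence of $G$. A graph class $\mathcal C$ has bounded merge-width if $\sup_{G\in\mathcal C}\mathrm{mw}_r(G)<\infty$ for every $r\in\mathbb N$. Flip-width. For $A,B\subseteq V(G)$ let $AB=\{\{a,b\}:a\in A,b\in B,a\neq b\}$. For a partition $\mathcal P$ of $V(G)$, a $\mathcal P$-flip of $G$ is a graph $G'$ on $V(G)$ such that for all $A,B\in\mathcal P$ (possibly $A=B$), either $E(G')\cap AB=E(G)\cap AB$ or $E(G')\cap AB=AB\setminus E(G)$.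 A $k$-flip is a $\mathcal P$-flip for some $\mathcal P$ with $|\mathcal P|\le k$. The flip-width game of radius $r$ and width $k$ on $G$ is played by flipper and runner. Set $G_0=G$. Initially runner picks $v_0\in V(G)$. In round $t=1,2,\dots$, flipper announces a $k$-flip $G_t$ of $G$; then runner picks $v_t$ at distance at most $r$ from $v_{t-1}$ in the previous graph $G_{t-1}$. Flipper wins if $v_t$ is isolated in $G_t$. The radius-$r$ flip-width $\mathrm{fw}_r(G)$ is the least $k$ such that flipper has a winning strategy in this game. A graph class $\mathcal C$ has bounded flip-width if $\sup_{G\in\mathcal C}\mathrm{fw}_r(G)<\infty$ for every $r\in\mathbb N$. *)

theory Defs
  imports Main "HOL-Library.Disjoint_Sets" "HOL-Library.Ramsey" "HOL-Library.Extended_Nat"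
begin

section \<open>Graphs\<close>

record 'a sgraph =
  verts :: "'a set"
  edges :: "'a set set"

definition simple_graph :: "'a sgraph \<Rightarrow> bool" where
  "simple_graph G \<longleftrightarrow> finite (verts G) \<and> edges G \<subseteq> [verts G]\<^bsup>2\<^esup>"

text \<open>A path is given by the nonempty list of its vertices; its length is \<open>length p - 1\<close>.\<close>

definition is_path :: "'a sgraph \<Rightarrow> 'a list \<Rightarrow> bool" where
  "is_path G p \<longleftrightarrow> p \<noteq> [] \<and> distinct p \<and> set p \<subseteq> verts G
     \<and> successively (\<lambda>x y. {x, y} \<in> edges G) p"

definition within_dist :: "'a sgraph \<Rightarrow> nat \<Rightarrow> 'a \<Rightarrow> 'a \<Rightarrow> bool" where
  "within_dist G r u v \<longleftrightarrow>
     (\<exists>p. is_path G p \<and> hd p = u \<and> last p = v \<and> length p - 1 \<le> r)"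

definition isolated_in :: "'a sgraph \<Rightarrow> 'a \<Rightarrow> bool" where
  "isolated_in G v \<longleftrightarrow> (\<forall>e\<in>edges G. v \<notin> e)"

definition pairs_between :: "'a set \<Rightarrow> 'a set \<Rightarrow> 'a set set" where
  "pairs_between A B = {{a, b} | a b. a \<in> A \<and> b \<in> B \<and> a \<noteq> b}"

section \<open>Merge-width\<close>

record 'a cstate =
  parts :: "'a set set"
  pos :: "'a set set"
  neg :: "'a set set"
  unres :: "'a set set"

definition initial_state :: "'a set \<Rightarrow> 'a cstate" where
  "initial_state V = \<lparr>parts = (\<lambda>v. {v}) ` V, pos = {}, neg = {}, unres = [V]\<^bsup>2\<^esup>\<rparr>"

inductive cstep :: "'a cstate \<Rightarrow> 'a cstate \<Rightarrow> bool" where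
  merge: "A \<in> parts s \<Longrightarrow> B \<in> parts s \<Longrightarrow> A \<noteq> B \<Longrightarrow>
    cstep s (s\<lparr>parts := insert (A \<union> B) (parts s - {A, B})\<rparr>)"
| resolve_pos: "A \<in> parts s \<Longrightarrow> B \<in> parts s \<Longrightarrow>
    cstep s (s\<lparr>pos := pos s \<union> (unres s \<inter> pairs_between A B),
               unres := unres s - pairs_between A B\<rparr>)"
| resolve_neg: "A \<in> parts s \<Longrightarrow> B \<in> parts s \<Longrightarrow>
    cstep s (s\<lparr>neg := neg s \<union> (unres s \<inter> pairs_between A B),
               unres := unres s - pairs_between A B\<rparr>)"

text \<open>
  A construction sequence is recorded as the list of all its states, the initial one included.
  The final partition is required to have at most one part, so that the graph without
  vertices, whose only vertex partition is empty, is not excluded; for a nonempty vertex set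
  this means exactly one part.
\<close>

definition construction_sequence :: "'a sgraph \<Rightarrow> 'a cstate list \<Rightarrow> bool" where
  "construction_sequence G ss \<longleftrightarrow>
     ss \<noteq> [] \<and> hd ss = initial_state (verts G) \<and> successively cstep ss
     \<and> card (parts (last ss)) \<le> 1 \<and> unres (last ss) = {} \<and> pos (last ss) = edges G"

definition reachable_parts :: "nat \<Rightarrow> 'a set \<Rightarrow> 'a cstate \<Rightarrow> 'a \<Rightarrow> 'a set set" where
  "reachable_parts r V s v =
     {A \<in> parts s. \<exists>u\<in>A. within_dist \<lparr>verts = V, edges = pos s \<union> neg s\<rparr> r v u}"

definition sequence_width :: "nat \<Rightarrow> 'a set \<Rightarrow> 'a cstate list \<Rightarrow> nat" where
  "sequence_width r V ss =
     (LEAST k. \<forall>s\<in>set ss. \<forall>v\<in>V. card (reachable_parts r V s v) \<le> k)"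

definition merge_width :: "nat \<Rightarrow> 'a sgraph \<Rightarrow> enat" where
  "merge_width r G =
     (INF ss\<in>{ss. construction_sequence G ss}. enat (sequence_width r (verts G) ss))"

definition bounded_merge_width :: "'a sgraph set \<Rightarrow> bool" where
  "bounded_merge_width C \<longleftrightarrow> (\<forall>r. (SUP G\<in>C. merge_width r G) < \<infinity>)"

section \<open>Flip-width\<close>

definition is_flip :: "'a set set \<Rightarrow> 'a sgraph \<Rightarrow> 'a sgraph \<Rightarrow> bool" where
  "is_flip P G G' \<longleftrightarrow> simple_graph G' \<and> verts G' = verts G \<and>
     (\<forall>A\<in>P. \<forall>B\<in>P.
        edges G' \<inter> pairs_between A B = edges G \<inter> pairs_between A B
      \<or> edges G' \<inter> pairs_between A B = pairs_between A B - edges G)"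

definition is_k_flip :: "nat \<Rightarrow> 'a sgraph \<Rightarrow> 'a sgraph \<Rightarrow> bool" where
  "is_k_flip k G G' \<longleftrightarrow> (\<exists>P. partition_on (verts G) P \<and> card P \<le> k \<and> is_flip P G G')"

text \<open>
  A strategy of flipper maps the history \<open>[v\<^sub>0, \<dots>, v\<^sub>t\<^sub>-\<^sub>1]\<close> of runner's positions to the flip
  \<open>G\<^sub>t\<close> announced in round \<open>t \<ge> 1\<close>; flipper's own earlier moves are determined by the strategy.
  Runner can always stay put, so every legal partial play extends to an infinite sequence \<open>v\<close>,
  and it suffices to consider those; flipper wins if the winning position occurs in some round.
\<close>

definition flipper_strategy :: "nat \<Rightarrow> 'a sgraph \<Rightarrow> ('a list \<Rightarrow> 'a sgraph) \<Rightarrow> bool" where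
  "flipper_strategy k G \<sigma> \<longleftrightarrow>
     (\<forall>h. h \<noteq> [] \<and> set h \<subseteq> verts G \<longrightarrow> is_k_flip k G (\<sigma> h))"

definition game_graph :: "'a sgraph \<Rightarrow> ('a list \<Rightarrow> 'a sgraph) \<Rightarrow> (nat \<Rightarrow> 'a) \<Rightarrow> nat \<Rightarrow> 'a sgraph" where
  "game_graph G \<sigma> v t = (if t = 0 then G else \<sigma> (map v [0..<t]))"

definition runner_play ::
  "nat \<Rightarrow> 'a sgraph \<Rightarrow> ('a list \<Rightarrow> 'a sgraph) \<Rightarrow> (nat \<Rightarrow> 'a) \<Rightarrow> bool" where
  "runner_play r G \<sigma> v \<longleftrightarrow> v 0 \<in> verts G
     \<and> (\<forall>t\<ge>1. within_dist (game_graph G \<sigma> v (t - 1)) r (v (t - 1)) (v t))"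

definition flipper_wins :: "nat \<Rightarrow> nat \<Rightarrow> 'a sgraph \<Rightarrow> bool" where
  "flipper_wins r k G \<longleftrightarrow>
     (\<exists>\<sigma>. flipper_strategy k G \<sigma> \<and>
       (\<forall>v. runner_play r G \<sigma> v \<longrightarrow> (\<exists>t\<ge>1. isolated_in (game_graph G \<sigma> v t) (v t))))"

definition flip_width :: "nat \<Rightarrow> 'a sgraph \<Rightarrow> enat" where
  "flip_width r G = (INF k\<in>{k. flipper_wins r k G}. enat k)"

definition bounded_flip_width :: "'a sgraph set \<Rightarrow> bool" where
  "bounded_flip_width C \<longleftrightarrow> (\<forall>r. (SUP G\<in>C. flip_width r G) < \<infinity>)"

end

theory Submission imports Defs begin

text \<open>
  Flipper plays a construction sequence \<open>s\<^sub>0, \<dots>, s\<^sub>n\<close> of small width backwards, one state per round.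
  Call a pair resolved in a state when it is a positive or a negative pair of that state.

  The sets of unresolved pairs between two parts of a state are homogeneous: since parts only
  grow, all these pairs are resolved at the same moment and with the same sign
  (\<open>unresolved_homogeneous\<close>). Hence, given few parts \<open>K\<close> of a state, flipping every pair of a part
  \<open>A \<in> K\<close> with every part that is to be joined to \<open>A\<close> positively turns all unresolved pairs
  meeting \<open>\<Union>K\<close> into non-edges. Only the resolved pairs can still be edges at \<open>\<Union>K\<close>
  (\<open>local_flip_edges_resolved\<close>). Such a flip is determined by the traces of the vertices on two
  families indexed by \<open>K\<close>, so it is a \<open>4 ^ card K\<close>-flip (\<open>family_flip_is_k_flip\<close>).

  In round \<open>t\<close> flipper takes the state \<open>s = s\<^sub>n\<^sub>-\<^sub>t\<close> and lets \<open>K\<close> be the parts of \<open>s\<close> that meet the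
  ball of radius \<open>2r\<close> around the last known position \<open>v\<^sub>t\<^sub>-\<^sub>1\<close>, measured in the resolved pairs of
  the following state \<open>s'\<close>. A step of a construction sequence changes either the partition or the
  resolved pairs but not both, so \<open>K\<close> is still bounded by the width at radius \<open>2r\<close>
  (\<open>card_next_reachable\<close>). Runner's move to \<open>v\<^sub>t\<close> used only resolved pairs of \<open>s'\<close>, so \<open>v\<^sub>t\<close> has
  distance at most \<open>r\<close> from \<open>v\<^sub>t\<^sub>-\<^sub>1\<close> there; a path of length at most \<open>r\<close> from \<open>v\<^sub>t\<close> in the
  announced flip cannot leave that ball of radius \<open>2r\<close>, hence not \<open>\<Union>K\<close>, and uses only resolved pairs
  of \<open>s\<close> (\<open>flip_path_resolved\<close>). So the invariant is restored with \<open>s\<close> in place of \<open>s'\<close>. Once the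
  initial state is reached nothing is resolved, and runner's position is isolated.
\<close>

section \<open>Distances\<close>

lemma within_dist_verts:
  assumes "within_dist G r u v"
  shows "v \<in> verts G"
  using assms by (auto simp: within_dist_def is_path_def)

lemma within_dist_mono:
  assumes "within_dist G r u v" "verts G = verts H" "edges G \<subseteq> edges H" "r \<le> r'"
  shows "within_dist H r' u v"
proof -
  obtain p where p: "is_path G p" "hd p = u" "last p = v" "length p - 1 \<le> r"
    using assms(1) unfolding within_dist_def by blast
  have "is_path H p"
    using p(1) assms(2,3) unfolding is_path_def
    by (auto elim!: successively_mono)
  then show ?thesis
    using p assms(4) le_trans unfolding within_dist_def by blast
qed

text \<open>
  Paths have no repeated vertices, so if the new vertex already lies on the path, the path is cut
  off there instead of being extended.
\<close>

lemma within_dist_step: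
  assumes "within_dist G r u v" "{v, w} \<in> edges G" "w \<in> verts G"
  shows "within_dist G (Suc r) u w"
proof -
  obtain p where p: "is_path G p" "hd p = u" "last p = v" "length p - 1 \<le> r"
    using assms(1) unfolding within_dist_def by blast
  show ?thesis
  proof (cases "w \<in> set p")
    case True
    then obtain xs ys where "p = xs @ w # ys" by (meson split_list)
    then have q: "p = (xs @ [w]) @ ys" by simp
    have "is_path G (xs @ [w])"
      using p(1) unfolding q is_path_def successively_append_iff by auto
    moreover have "hd (xs @ [w]) = u" using p(2) unfolding q by (cases xs) auto
    moreover have "length (xs @ [w]) - 1 \<le> Suc r" using p(4) unfolding q by simp
    ultimately show ?thesis unfolding within_dist_def by (metis last_snoc)
  next
    case False
    then have "is_path G (p @ [w])"
      using p(1,3) assms(2,3) unfolding is_path_def successively_append_iff by auto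
    moreover have "hd (p @ [w]) = u" using p(1,2) by (simp add: is_path_def)
    moreover have "length (p @ [w]) - 1 \<le> Suc r" using p(4) by simp
    ultimately show ?thesis unfolding within_dist_def by (metis last_snoc)
  qed
qed

text \<open>
  As long as a path of \<open>H\<close> stays in the ball of radius \<open>2r\<close> around \<open>u\<close>, its edges lie in \<open>S \<subseteq> R\<close>,
  so each of its steps increases the distance from \<open>u\<close> in \<open>R\<close> by at most one. Starting at distance
  at most \<open>r\<close>, a path of length at most \<open>r\<close> therefore never leaves the ball.
\<close>

lemma confined_path:
  assumes "is_path H p" "length p - 1 \<le> r" "within_dist R r u (hd p)"
    and verts: "verts S = verts H" "verts R = verts H"
    and "edges S \<subseteq> edges R"
    and conf: "\<And>x y. within_dist R (2 * r) u x \<Longrightarrow> {x, y} \<in> edges H \<Longrightarrow> {x, y} \<in> edges S"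
  shows "is_path S p \<and> within_dist R (r + (length p - 1)) u (last p)"
proof -
  have "p \<noteq> []" using assms(1) by (simp add: is_path_def)
  then show ?thesis using assms(1-3)
  proof (induction p rule: rev_nonempty_induct)
    case (single x)
    then show ?case using verts by (simp add: is_path_def)
  next
    case (snoc y xs)
    have "is_path H xs" and edge: "{last xs, y} \<in> edges H" and y: "y \<in> verts H"
      using snoc.prems(1) snoc.hyps by (auto simp: is_path_def successively_append_iff)
    then have IH: "is_path S xs" "within_dist R (r + (length xs - 1)) u (last xs)"
      using snoc.IH snoc.prems(2,3) snoc.hyps by auto
    have len: "Suc (length xs - 1) = length xs" using snoc.hyps by (cases xs) auto
    have "within_dist R (2 * r) u (last xs)"
      using within_dist_mono[OF IH(2)] snoc.prems(2) by auto
    then have S: "{last xs, y} \<in> edges S" using conf edge by blast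
    have "within_dist R (Suc (r + (length xs - 1))) u y"
      using within_dist_step[OF IH(2)] S \<open>edges S \<subseteq> edges R\<close> y verts by auto
    moreover have "is_path S (xs @ [y])"
      using IH(1) S snoc.prems(1) verts
      by (auto simp: is_path_def successively_append_iff)
    moreover have "r + (length (xs @ [y]) - 1) = Suc (r + (length xs - 1))" using len by simp
    ultimately show ?case by (metis last_snoc)
  qed
qed

section \<open>Construction sequences\<close>

definition valid_state :: "'a set \<Rightarrow> 'a cstate \<Rightarrow> bool" where
  "valid_state V s \<longleftrightarrow> partition_on V (parts s)
     \<and> pos s \<union> neg s \<union> unres s = [V]\<^bsup>2\<^esup> \<and> pos s \<inter> unres s = {}"

definition resolved_graph :: "'a set \<Rightarrow> 'a cstate \<Rightarrow> 'a sgraph" where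
  "resolved_graph V s = \<lparr>verts = V, edges = pos s \<union> neg s\<rparr>"

lemma resolved_graph_simps [simp]:
  "verts (resolved_graph V s) = V" "edges (resolved_graph V s) = pos s \<union> neg s"
  by (simp_all add: resolved_graph_def)

lemma partition_on_merge:
  assumes "partition_on V P" "A \<in> P" "B \<in> P"
  shows "partition_on V (insert (A \<union> B) (P - {A, B}))"
proof (rule partition_onI)
  show "\<Union>(insert (A \<union> B) (P - {A, B})) = V"
    using assms partition_onD1[OF assms(1)] by auto
  show "{} \<notin> insert (A \<union> B) (P - {A, B})"
    using assms partition_onD3[OF assms(1)] by auto
  have old: "disjnt p q" if "p \<in> P" "q \<in> P" "p \<noteq> q" for p q
    using that partition_onD2[OF assms(1)] by (auto simp: disjoint_def disjnt_def)
  then have new: "disjnt (A \<union> B) q" if "q \<in> P - {A, B}" for q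
    using that old[of A q] old[of B q] assms(2,3) by auto
  show "disjnt p q"
    if "p \<in> insert (A \<union> B) (P - {A, B})" "q \<in> insert (A \<union> B) (P - {A, B})" "p \<noteq> q" for p q
    using that old[of p q] new[of p] new[of q] disjnt_sym[of "A \<union> B" p] by blast
qed

lemma valid_initial_state: "valid_state V (initial_state V)"
  unfolding valid_state_def initial_state_def
  by (auto intro!: partition_onI)

lemma cstep_valid: "cstep s s' \<Longrightarrow> valid_state V s \<Longrightarrow> valid_state V s'"
proof (induction rule: cstep.induct)
  case (merge A s B)
  then show ?case by (simp add: valid_state_def partition_on_merge)
qed (auto simp: valid_state_def)

lemma cstep_mono:
  assumes "cstep s s'"
  shows "pos s \<subseteq> pos s'" "neg s \<subseteq> neg s'" "unres s' \<subseteq> unres s" "pos s' \<subseteq> pos s \<union> unres s"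
  using assms by (induction rule: cstep.induct) auto

lemma csteps_pos_mono: "cstep\<^sup>*\<^sup>* s s' \<Longrightarrow> pos s \<subseteq> pos s'"
  by (induction rule: rtranclp_induct) (auto dest: cstep_mono)

lemma csteps_pos_from_unres: "cstep\<^sup>*\<^sup>* s s' \<Longrightarrow> pos s' \<subseteq> pos s \<union> unres s"
  by (induction rule: converse_rtranclp_induct) (use cstep_mono in blast)+

lemma pairs_between_commute: "pairs_between A B = pairs_between B A"
  unfolding pairs_between_def by (auto simp: insert_commute)

lemma pairs_between_mono: "A \<subseteq> A' \<Longrightarrow> B \<subseteq> B' \<Longrightarrow> pairs_between A B \<subseteq> pairs_between A' B'"
  unfolding pairs_between_def by blast

lemma pairs_between_parts:
  assumes "partition_on V P" "A \<in> P" "B \<in> P" "C \<in> P" "D \<in> P"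
  shows "pairs_between A B = pairs_between C D \<or> pairs_between A B \<inter> pairs_between C D = {}"
proof (rule disjCI)
  assume "pairs_between A B \<inter> pairs_between C D \<noteq> {}"
  then obtain a b c d where e: "{a, b} = {c, d}" "a \<in> A" "b \<in> B" "c \<in> C" "d \<in> D"
    unfolding pairs_between_def by blast
  have same: "X = Y" if "x \<in> X" "x \<in> Y" "X \<in> P" "Y \<in> P" for x X Y
    using that partition_onD2[OF assms(1)] by (auto simp: disjoint_def)
  have "A = C \<and> B = D \<or> A = D \<and> B = C"
    using e assms(2-5) same by (auto simp: doubleton_eq_iff)
  then show "pairs_between A B = pairs_between C D"
    using pairs_between_commute by blast
qed

text \<open>
  Backwards along the sequence: a merge only enlarges the set of pairs for which the claim is
  known, and a resolution either settles all unresolved pairs between the two given parts or,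
  the parts being disjoint, none of them.
\<close>

lemma unresolved_homogeneous:
  assumes "cstep\<^sup>*\<^sup>* s s'" "valid_state V s" "A \<in> parts s" "B \<in> parts s"
  shows "unres s \<inter> pairs_between A B \<subseteq> pos s' \<or> unres s \<inter> pairs_between A B \<inter> pos s' \<subseteq> unres s'"
  using assms
proof (induction arbitrary: A B rule: converse_rtranclp_induct)
  case base
  then show ?case by blast
next
  case (step s t)
  have "valid_state V t" using cstep_valid step by blast
  note IH = step.IH[OF this]
  have part: "partition_on V (parts s)" using step.prems by (simp add: valid_state_def)
  show ?case using step.hyps(1)
  proof cases
    case (merge C D)
    have "\<exists>X'\<in>parts t. X \<subseteq> X'" if "X \<in> parts s" for X
      using that merge by auto
    then obtain A' B' where "A' \<in> parts t" "B' \<in> parts t" "A \<subseteq> A'" "B \<subseteq> B'"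
      using step.prems by meson
    then show ?thesis
      using IH[of A' B'] pairs_between_mono[of A A' B B'] merge by auto
  next
    case (resolve_pos C D)
    show ?thesis
    proof (cases "pairs_between A B = pairs_between C D")
      case True
      then have "unres s \<inter> pairs_between A B \<subseteq> pos t" using resolve_pos by auto
      then show ?thesis using csteps_pos_mono[OF step.hyps(2)] by blast
    next
      case False
      then have "pairs_between A B \<inter> pairs_between C D = {}"
        using pairs_between_parts part step.prems resolve_pos by blast
      then have "unres t \<inter> pairs_between A B = unres s \<inter> pairs_between A B"
        using resolve_pos by auto
      then show ?thesis using IH[of A B] step.prems resolve_pos by auto
    qed
  next
    case (resolve_neg C D)
    show ?thesis
    proof (cases "pairs_between A B = pairs_between C D")
      case True
      then have "unres s \<inter> pairs_between A B \<inter> (pos t \<union> unres t) = {}"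
        using resolve_neg step.prems(1) by (auto simp: valid_state_def)
      then show ?thesis using csteps_pos_from_unres[OF step.hyps(2)] by blast
    next
      case False
      then have "pairs_between A B \<inter> pairs_between C D = {}"
        using pairs_between_parts part step.prems resolve_neg by blast
      then have "unres t \<inter> pairs_between A B = unres s \<inter> pairs_between A B"
        using resolve_neg by auto
      then show ?thesis using IH[of A B] step.prems resolve_neg by auto
    qed
  qed
qed

lemma construction_sequence_csteps:
  assumes "construction_sequence G ss" "i \<le> j" "j < length ss"
  shows "cstep\<^sup>*\<^sup>* (ss ! i) (ss ! j)"
  using assms(2,3)
proof (induction j rule: dec_induct)
  case base
  then show ?case by simp
next
  case (step j)
  then have "cstep (ss ! j) (ss ! Suc j)"
    using assms(1) by (simp add: construction_sequence_def successively_conv_nth)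
  with step show ?case by (simp add: rtranclp.rtrancl_into_rtrancl)
qed

lemma construction_sequence_valid:
  assumes "construction_sequence G ss" "i < length ss"
  shows "valid_state (verts G) (ss ! i)"
proof -
  have "ss ! 0 = initial_state (verts G)"
    using assms(1) unfolding construction_sequence_def by (metis hd_conv_nth)
  moreover have "valid_state (verts G) s \<Longrightarrow> cstep\<^sup>*\<^sup>* s s' \<Longrightarrow> valid_state (verts G) s'" for s s'
    by (rotate_tac 1, induction rule: rtranclp_induct) (auto intro: cstep_valid)
  ultimately show ?thesis
    using construction_sequence_csteps[OF assms(1), of 0 i] assms(2) valid_initial_state
    by (metis le0)
qed

lemma sequence_width_bound:
  assumes "finite V" "s \<in> set ss" "v \<in> V"
  shows "card (reachable_parts r V s v) \<le> sequence_width r V ss"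
proof -
  let ?f = "\<lambda>(s, v). card (reachable_parts r V s v)"
  have "\<forall>s\<in>set ss. \<forall>v\<in>V. card (reachable_parts r V s v) \<le> Max (?f ` (set ss \<times> V))"
    using assms(1) by (auto intro!: Max_ge image_eqI)
  then have "\<exists>k. \<forall>s\<in>set ss. \<forall>v\<in>V. card (reachable_parts r V s v) \<le> k" by blast
  from LeastI_ex[OF this] show ?thesis
    using assms(2,3) unfolding sequence_width_def by blast
qed

section \<open>Local flips\<close>

lemma pair_in_pairs_between_iff:
  "{x, y} \<in> pairs_between A B \<longleftrightarrow> x \<noteq> y \<and> (x \<in> A \<and> y \<in> B \<or> y \<in> A \<and> x \<in> B)"
  unfolding pairs_between_def by (auto simp: doubleton_eq_iff)

lemma pair_in_nsets_iff: "{x, y} \<in> [V]\<^bsup>2\<^esup> \<longleftrightarrow> x \<in> V \<and> y \<in> V \<and> x \<noteq> y"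
  unfolding nsets_def by (auto simp: card_insert_if)

definition flipped_pairs :: "'a set set \<Rightarrow> ('a set \<Rightarrow> 'a set) \<Rightarrow> 'a set set" where
  "flipped_pairs K N = (\<Union>A\<in>K. pairs_between A (N A))"

definition family_flip :: "'a sgraph \<Rightarrow> 'a set set \<Rightarrow> ('a set \<Rightarrow> 'a set) \<Rightarrow> 'a sgraph" where
  "family_flip G K N = \<lparr>verts = verts G,
     edges = {e \<in> [verts G]\<^bsup>2\<^esup>. e \<in> edges G \<longleftrightarrow> e \<notin> flipped_pairs K N}\<rparr>"

lemma verts_family_flip [simp]: "verts (family_flip G K N) = verts G"
  by (simp add: family_flip_def)

text \<open>
  Whether a pair is flipped depends only on which \<open>A\<close> and which \<open>N A\<close> contain its two vertices,
  so the vertices may be partitioned by these two subsets of \<open>K\<close>.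
\<close>

lemma family_flip_is_k_flip:
  assumes "simple_graph G" "finite K"
  shows "is_k_flip (4 ^ card K) G (family_flip G K N)"
proof -
  let ?V = "verts G" and ?H = "family_flip G K N"
  define trace where "trace x = ({A \<in> K. x \<in> A}, {A \<in> K. x \<in> N A})" for x
  define cls where "cls x = {y \<in> ?V. trace y = trace x}" for x
  have part: "partition_on ?V (cls ` ?V)"
    by (rule partition_onI) (auto simp: cls_def disjnt_def)
  have sub: "trace ` ?V \<subseteq> Pow K \<times> Pow K" by (auto simp: trace_def)
  have fin: "finite (Pow K \<times> Pow K)" using assms(2) by simp
  have "cls ` ?V = (\<lambda>c. {y \<in> ?V. trace y = c}) ` trace ` ?V"
    by (simp add: cls_def image_image)
  then have "card (cls ` ?V) \<le> card (trace ` ?V)"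
    using card_image_le[OF finite_subset[OF sub fin]] by simp
  also have "\<dots> \<le> card (Pow K \<times> Pow K)" using card_mono[OF fin sub] .
  also have "\<dots> = 2 ^ card K * 2 ^ card K"
    using assms(2) by (simp add: card_cartesian_product card_Pow)
  also have "\<dots> = 4 ^ card K" by (simp flip: power_mult_distrib)
  finally have card: "card (cls ` ?V) \<le> 4 ^ card K" .
  have "edges ?H \<inter> pairs_between (cls a) (cls b) = edges G \<inter> pairs_between (cls a) (cls b)
      \<or> edges ?H \<inter> pairs_between (cls a) (cls b) = pairs_between (cls a) (cls b) - edges G" for a b
  proof -
    let ?\<Phi> = "\<exists>A\<in>K. a \<in> A \<and> b \<in> N A \<or> b \<in> A \<and> a \<in> N A"
    have "e \<in> edges ?H \<longleftrightarrow> (e \<in> edges G \<longleftrightarrow> \<not> ?\<Phi>)"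
      if e_in: "e \<in> pairs_between (cls a) (cls b)" for e
    proof -
      obtain x y where e: "e = {x, y}" "x \<in> cls a" "y \<in> cls b" "x \<noteq> y"
        using e_in unfolding pairs_between_def by blast
      have "(x \<in> A \<longleftrightarrow> a \<in> A) \<and> (x \<in> N A \<longleftrightarrow> a \<in> N A) \<and> (y \<in> A \<longleftrightarrow> b \<in> A)
          \<and> (y \<in> N A \<longleftrightarrow> b \<in> N A)" if "A \<in> K" for A
        using e(2,3) that by (auto simp: cls_def trace_def)
      then have "e \<in> flipped_pairs K N \<longleftrightarrow> ?\<Phi>"
        using e(4) unfolding e(1) flipped_pairs_def UN_iff pair_in_pairs_between_iff by blast
      moreover have "e \<in> [?V]\<^bsup>2\<^esup>"
        using e unfolding e(1) pair_in_nsets_iff by (simp add: cls_def)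
      ultimately show ?thesis by (simp add: family_flip_def)
    qed
    then show ?thesis by (cases ?\<Phi>) blast+
  qed
  moreover have "simple_graph ?H"
    using assms(1) by (auto simp: simple_graph_def family_flip_def)
  ultimately have "is_flip (cls ` ?V) G ?H" by (auto simp: is_flip_def)
  with part card show ?thesis unfolding is_k_flip_def by blast
qed

lemma is_k_flip_mono: "is_k_flip k G G' \<Longrightarrow> k \<le> l \<Longrightarrow> is_k_flip l G G'"
  unfolding is_k_flip_def using le_trans by blast

definition positive_partners :: "'a cstate \<Rightarrow> 'a set set \<Rightarrow> 'a set \<Rightarrow> 'a set" where
  "positive_partners s E A = \<Union>{B \<in> parts s. unres s \<inter> pairs_between A B \<subseteq> E}"

text \<open>
  An unresolved pair between \<open>A \<in> K\<close> and a part \<open>B\<close> is an edge exactly if, by homogeneity, all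
  unresolved pairs between \<open>A\<close> and \<open>B\<close> are edges, which is exactly when the pair is flipped.
\<close>

lemma local_flip_edges_resolved:
  assumes valid: "valid_state (verts G) s"
    and steps: "cstep\<^sup>*\<^sup>* s s'" "unres s' = {}" "pos s' = edges G"
    and K: "K \<subseteq> parts s" "x \<in> \<Union>K"
    and edge: "{x, y} \<in> edges (family_flip G K (positive_partners s (edges G)))"
  shows "{x, y} \<in> pos s \<union> neg s"
proof (rule ccontr)
  assume "{x, y} \<notin> pos s \<union> neg s"
  let ?N = "positive_partners s (edges G)"
  have xy: "{x, y} \<in> [verts G]\<^bsup>2\<^esup>"
    and flip: "{x, y} \<in> edges G \<longleftrightarrow> {x, y} \<notin> flipped_pairs K ?N"
    using edge by (auto simp: family_flip_def)
  then have V: "x \<in> verts G" "y \<in> verts G" "x \<noteq> y" by (simp_all add: pair_in_nsets_iff)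
  have part: "partition_on (verts G) (parts s)" using valid by (simp add: valid_state_def)
  have same: "X = Y" if "z \<in> X" "z \<in> Y" "X \<in> parts s" "Y \<in> parts s" for z X Y
    using that partition_onD2[OF part] by (auto simp: disjoint_def)
  have unres: "{x, y} \<in> unres s"
    using valid xy \<open>{x, y} \<notin> pos s \<union> neg s\<close> by (auto simp: valid_state_def)
  obtain A where A: "A \<in> K" "A \<in> parts s" "x \<in> A" using K by blast
  obtain B where B: "B \<in> parts s" "y \<in> B" using V(2) partition_onD1[OF part] by blast
  have AB: "{x, y} \<in> pairs_between A B" using A B V(3) unfolding pairs_between_def by blast
  show False
  proof (cases "{x, y} \<in> edges G")
    case True
    then have "unres s \<inter> pairs_between A B \<subseteq> edges G"
      using unresolved_homogeneous[OF steps(1) valid A(2) B(1)] steps(2,3) unres AB by auto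
    then have "y \<in> ?N A" using B by (auto simp: positive_partners_def)
    then show False using True flip A V(3)
      unfolding flipped_pairs_def UN_iff pair_in_pairs_between_iff by blast
  next
    case False
    then have not_pos: "\<not> unres s \<inter> pairs_between A B \<subseteq> edges G" using unres AB by blast
    have "y \<notin> ?N A"
      using not_pos same B by (auto simp: positive_partners_def)
    moreover have "x \<notin> ?N B"
      using not_pos same A by (auto simp: positive_partners_def pairs_between_commute[of A B])
    ultimately have "{x, y} \<notin> flipped_pairs K ?N"
      using K(1) same A(2,3) B
      unfolding flipped_pairs_def UN_iff pair_in_pairs_between_iff by blast
    then show False using False flip by blast
  qed
qed

section \<open>The strategy of flipper\<close>

definition next_reachable :: "nat \<Rightarrow> 'a set \<Rightarrow> 'a cstate \<Rightarrow> 'a cstate \<Rightarrow> 'a \<Rightarrow> 'a set set" where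
  "next_reachable r V s s' v = {A \<in> parts s. \<exists>u\<in>A. within_dist (resolved_graph V s') r v u}"

text \<open>
  A merge leaves the resolved pairs unchanged and a resolution leaves the partition unchanged, so
  the mixture of the two states describes the reachable parts of one of them.
\<close>

lemma card_next_reachable:
  assumes "s = s' \<or> cstep s s'" "s \<in> set ss" "s' \<in> set ss" "finite V" "v \<in> V"
  shows "card (next_reachable r V s s' v) \<le> sequence_width r V ss"
proof -
  have "next_reachable r V s s' v = reachable_parts r V s v
      \<or> next_reachable r V s s' v = reachable_parts r V s' v"
    using assms(1)
    by (auto elim!: cstep.cases simp: next_reachable_def reachable_parts_def resolved_graph_def)
  then show ?thesis using sequence_width_bound[of V _ ss v r] assms(2-5) by metis
qed

text \<open>
  The radius of the ball is doubled because the flip is fixed knowing only the position \<open>v\<close>,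
  while runner continues from some vertex at distance up to \<open>r\<close> from \<open>v\<close>.
\<close>

definition backward_flip :: "nat \<Rightarrow> 'a sgraph \<Rightarrow> 'a cstate \<Rightarrow> 'a cstate \<Rightarrow> 'a \<Rightarrow> 'a sgraph" where
  "backward_flip r G s s' v =
     family_flip G (next_reachable (2 * r) (verts G) s s' v) (positive_partners s (edges G))"

lemma verts_backward_flip [simp]: "verts (backward_flip r G s s' v) = verts G"
  by (simp add: backward_flip_def)

lemma backward_flip_resolved:
  assumes "valid_state (verts G) s" "cstep\<^sup>*\<^sup>* s s\<^sub>n" "unres s\<^sub>n = {}" "pos s\<^sub>n = edges G"
    and near: "within_dist (resolved_graph (verts G) s') (2 * r) v x"
    and "{x, y} \<in> edges (backward_flip r G s s' v)"
  shows "{x, y} \<in> pos s \<union> neg s"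
proof -
  have "x \<in> verts G" using within_dist_verts[OF near] by simp
  then obtain A where "A \<in> parts s" "x \<in> A"
    using assms(1) unfolding valid_state_def partition_on_def by blast
  then have "x \<in> \<Union>(next_reachable (2 * r) (verts G) s s' v)"
    using near by (auto simp: next_reachable_def)
  then show ?thesis
    using local_flip_edges_resolved[OF assms(1-4) _ _ assms(6)[unfolded backward_flip_def]]
    by (simp add: next_reachable_def)
qed

lemma flip_path_resolved:
  assumes "valid_state (verts G) s" "cstep\<^sup>*\<^sup>* s s\<^sub>n" "unres s\<^sub>n = {}" "pos s\<^sub>n = edges G"
    and "pos s \<union> neg s \<subseteq> pos s' \<union> neg s'"
    and "within_dist (resolved_graph (verts G) s') r v x"
    and "within_dist (backward_flip r G s s' v) r x y"
  shows "within_dist (resolved_graph (verts G) s) r x y"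
proof -
  obtain p where p: "is_path (backward_flip r G s s' v) p" "hd p = x" "last p = y" "length p - 1 \<le> r"
    using assms(7) unfolding within_dist_def by blast
  have "is_path (resolved_graph (verts G) s) p"
    using confined_path[OF p(1,4), of "resolved_graph (verts G) s'" v "resolved_graph (verts G) s"]
      backward_flip_resolved[OF assms(1-4)] assms(5,6) p(2) by auto
  then show ?thesis using p unfolding within_dist_def by blast
qed

lemma flipper_wins_if_construction_sequence:
  assumes G: "simple_graph G" and ss: "construction_sequence G ss"
  shows "flipper_wins r (4 ^ sequence_width (2 * r) (verts G) ss) G"
proof -
  define n where "n = length ss - 1"
  define s where "s t = ss ! (n - t)" for t
  have len: "length ss = Suc n" using ss by (cases ss) (auto simp: n_def construction_sequence_def)
  have in_ss: "s t \<in> set ss" for t by (simp add: s_def len)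
  have valid: "valid_state (verts G) (s t)" for t
    using construction_sequence_valid[OF ss] len by (simp add: s_def)
  have "s 0 = last ss" using len by (simp add: s_def last_conv_nth flip: length_greater_0_conv)
  then have last: "unres (s 0) = {}" "pos (s 0) = edges G"
    using ss by (auto simp: construction_sequence_def)
  have steps: "cstep\<^sup>*\<^sup>* (s t) (s 0)" for t
    using construction_sequence_csteps[OF ss] len by (simp add: s_def)
  have step: "s (Suc t) = s t \<or> cstep (s (Suc t)) (s t)" for t
  proof (cases "t < n")
    case True
    then have "n - t = Suc (n - Suc t)" by simp
    then show ?thesis
      using ss len by (simp add: s_def construction_sequence_def successively_conv_nth)
  qed (simp add: s_def)
  have initial: "pos (s (Suc n)) \<union> neg (s (Suc n)) = {}"
    using ss len by (simp add: s_def construction_sequence_def initial_state_def hd_conv_nth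
        flip: length_greater_0_conv)

  let ?R = "\<lambda>t. resolved_graph (verts G) (s t)"
  define \<sigma> where "\<sigma> h = backward_flip r G (s (length h)) (s (length h - 1)) (last h)" for h
  have "flipper_strategy (4 ^ sequence_width (2 * r) (verts G) ss) G \<sigma>"
    unfolding flipper_strategy_def
  proof (intro allI impI)
    fix h :: "'a list"
    assume h: "h \<noteq> [] \<and> set h \<subseteq> verts G"
    let ?K = "next_reachable (2 * r) (verts G) (s (length h)) (s (length h - 1)) (last h)"
    have fin: "finite (verts G)" using G by (simp add: simple_graph_def)
    moreover have "last h \<in> verts G" using h by auto
    moreover have "s (length h) = s (length h - 1) \<or> cstep (s (length h)) (s (length h - 1))"
      using step[of "length h - 1"] h by simp
    ultimately have "card ?K \<le> sequence_width (2 * r) (verts G) ss"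
      using card_next_reachable[OF _ in_ss in_ss] by blast
    then have "4 ^ card ?K \<le> (4::nat) ^ sequence_width (2 * r) (verts G) ss"
      by (simp add: power_increasing)
    moreover have "finite (parts (s (length h)))"
      using valid fin by (auto simp: valid_state_def intro: finite_elements)
    then have "finite ?K" by (simp add: next_reachable_def)
    ultimately show "is_k_flip (4 ^ sequence_width (2 * r) (verts G) ss) G (\<sigma> h)"
      using family_flip_is_k_flip[OF G] is_k_flip_mono unfolding \<sigma>_def backward_flip_def by blast
  qed
  moreover have "\<exists>t\<ge>1. isolated_in (game_graph G \<sigma> v t) (v t)" if play: "runner_play r G \<sigma> v" for v
  proof -
    have flip: "game_graph G \<sigma> v (Suc t) = backward_flip r G (s (Suc t)) (s t) (v t)" for t
      by (simp add: game_graph_def \<sigma>_def last_map)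
    have move: "within_dist (?R t) r (v t) (v (Suc t))" for t
    proof (induction t)
      case 0
      have "within_dist G r (v 0) (v 1)"
        using play by (auto simp: runner_play_def game_graph_def dest!: spec[of _ 1])
      then show ?case using within_dist_mono[of G r] last by auto
    next
      case (Suc t)
      have "within_dist (game_graph G \<sigma> v (Suc t)) r (v (Suc t)) (v (Suc (Suc t)))"
        using play by (auto simp: runner_play_def dest!: spec[of _ "Suc (Suc t)"])
      moreover have "pos (s (Suc t)) \<union> neg (s (Suc t)) \<subseteq> pos (s t) \<union> neg (s t)"
        using step[of t] cstep_mono by fastforce
      ultimately show ?case
        using flip_path_resolved[OF valid steps last _ Suc.IH] flip by simp
    qed
    \<comment> \<open>Round \<open>n\<close> would suffice unless \<open>n = 0\<close>; one round later the initial state is still used.\<close>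
    have "isolated_in (game_graph G \<sigma> v (Suc n)) (v (Suc n))"
      unfolding isolated_in_def
    proof (intro ballI notI)
      fix e assume e: "e \<in> edges (game_graph G \<sigma> v (Suc n))" "v (Suc n) \<in> e"
      then have "e \<in> [verts G]\<^bsup>2\<^esup>"
        by (simp add: flip backward_flip_def family_flip_def)
      then obtain y where y: "e = {v (Suc n), y}"
        using e(2) by (auto simp: nsets_2_eq insert_commute)
      have "within_dist (?R n) (2 * r) (v n) (v (Suc n))"
        using within_dist_mono[OF move[of n]] by simp
      then show False
        using backward_flip_resolved[OF valid steps last _ e(1)[unfolded flip y]]
          initial by blast
    qed
    then show ?thesis by (intro exI[of _ "Suc n"]) simp
  qed
  ultimately show ?thesis unfolding flipper_wins_def by blast
qed

lemma flip_width_le_merge_width: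
  assumes "simple_graph G" "merge_width (2 * r) G \<le> enat m"
  shows "flip_width r G \<le> enat (4 ^ m)"
proof -
  let ?S = "{ss. construction_sequence G ss}"
  let ?w = "\<lambda>ss. enat (sequence_width (2 * r) (verts G) ss)"
  have "?w ` ?S \<noteq> {}"
    using assms(2) unfolding merge_width_def by (metis Inf_empty enat_ord_code(5) not_le
        top_enat_def enat_ord_simps(4))
  \<comment> \<open>Extended naturals are well-ordered, so the infimum is attained.\<close>
  then have "Inf (?w ` ?S) \<in> ?w ` ?S" by (meson wellorder_InfI ex_in_conv)
  then obtain ss where ss: "construction_sequence G ss" "?w ss \<le> enat m"
    using assms(2) unfolding merge_width_def by auto
  have "flip_width r G \<le> enat (4 ^ sequence_width (2 * r) (verts G) ss)"
    unfolding flip_width_def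
    using flipper_wins_if_construction_sequence[OF assms(1) ss(1)] by (auto intro: INF_lower)
  also have "\<dots> \<le> enat (4 ^ m)" using ss(2) by (simp add: power_increasing)
  finally show ?thesis .
qed

theorem theorem1p7:
  fixes C :: "'a sgraph set"
  assumes "\<forall>G\<in>C. simple_graph G"
    and "bounded_merge_width C"
  shows "bounded_flip_width C"
  unfolding bounded_flip_width_def
proof
  fix r
  have "(SUP G\<in>C. merge_width (2 * r) G) < \<infinity>"
    using assms(2) by (simp add: bounded_merge_width_def)
  then obtain m where m: "(SUP G\<in>C. merge_width (2 * r) G) = enat m" by auto
  have "flip_width r G \<le> enat (4 ^ m)" if "G \<in> C" for G
    using flip_width_le_merge_width assms(1) that m by (metis SUP_upper)
  then have "(SUP G\<in>C. flip_width r G) \<le> enat (4 ^ m)" by (rule SUP_least)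
  then show "(SUP G\<in>C. flip_width r G) < \<infinity>" by (rule le_less_trans) simp
qed

end
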